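(* Let $r \ge 1$ be an integer and, for $n\ge 0$, let $D_r(n)$ be the number of Dyck paths of semi-length $n$ that have exactly $r$ peaks at every reached height; that is, if $k\ge 0$ is the maximal height of the path, then the path has exactly $r$ peaks of height $i$ for each $i\in\{1,\dots,k\}$. Then $D_r(n) \equiv 0 \pmod{r+1}$ for all $n>r$.
   Context: A Dyck path of semi-length $n$ is a lattice path from $(0,0)$ to $(2n,0)$ with steps $\mathtt{u}=(1,1)$ and $\mathtt{d}=(1,-1)$ that never goes below the $x$-axis. A peak is an occurrence of two consecutive steps $\mathtt{u}\mathtt{d}$; it has height $h$ if its $\mathtt{u}$ step ends at height (ordinate) $h$. *)

theory Defs
  imports "HOL-Number_Theory.Cong"
begin

text \<open>The steps \<open>u = (1,1)\<close> and \<open>d = (1,-1)\<close>. A lattice path starting at the origin is given by its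
  list of steps; the point reached after \<open>i\<close> steps is \<open>(i, height w i)\<close>.\<close>

datatype step = U | D

fun rise :: "step \<Rightarrow> int" where
  "rise U = 1"
| "rise D = -1"

definition height :: "step list \<Rightarrow> nat \<Rightarrow> int" where
  "height w i = sum_list (map rise (take i w))"

definition dyck_path :: "nat \<Rightarrow> step list \<Rightarrow> bool" where
  "dyck_path n w \<longleftrightarrow>
     length w = 2 * n \<and> height w (2 * n) = 0 \<and> (\<forall>i \<le> 2 * n. height w i \<ge> 0)"

definition max_height :: "step list \<Rightarrow> int" where
  "max_height w = Max (height w ` {0..length w})"

text \<open>A peak is identified with the index \<open>j\<close> of its \<open>u\<close> step, which ends at the point with
  abscissa \<open>j + 1\<close>.\<close>

definition peaks :: "step list \<Rightarrow> int \<Rightarrow> nat set" where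
  "peaks w h = {j. j + 1 < length w \<and> w ! j = U \<and> w ! (j + 1) = D \<and> height w (j + 1) = h}"

definition regular_dyck_paths :: "nat \<Rightarrow> nat \<Rightarrow> step list set" where
  "regular_dyck_paths r n =
     {w. dyck_path n w \<and> (\<forall>i \<in> {1..max_height w}. card (peaks w i) = r)}"

definition num_regular_dyck_paths :: "nat \<Rightarrow> nat \<Rightarrow> nat" where
  "num_regular_dyck_paths r n = card (regular_dyck_paths r n)"

lemma finite_peaks: "finite (peaks w h)"
  by (rule finite_subset[of _ "{..<length w}"]) (auto simp: peaks_def)

lemma finite_regular_dyck_paths: "finite (regular_dyck_paths r n)"
proof (rule finite_subset)
  have "x \<in> {U, D}" for x
    by (cases x) auto
  then show "regular_dyck_paths r n \<subseteq> {w. set w \<subseteq> {U, D} \<and> length w = 2 * n}"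
    by (auto simp: regular_dyck_paths_def dyck_path_def)
  show "finite {w. set w \<subseteq> {U, D} \<and> length w = 2 * n}"
    by (rule finite_lists_length_eq) simp
qed

end

theory Submission
  imports Defs
begin

text \<open>A Dyck path is the contour of a plane forest whose leaves at depth \<open>h\<close> are the peaks of height
  \<open>h\<close>. A nonempty forest amounts to the list \<open>L\<close> of the numbers of children of its roots together
  with the forest formed by those children, and it is regular iff \<open>L\<close> has exactly \<open>r\<close> zeros and
  the forest of children is regular. Hence the number of regular forests with \<open>n\<close> nodes and \<open>t\<close>
  roots is a sum, over such \<open>L\<close> of length \<open>t\<close>, of numbers of regular forests with \<open>n - t\<close> nodes, and
  divisibility by \<open>r + 1\<close> propagates from \<open>n - t\<close> to \<open>n\<close>. The only other contribution is \<open>n - t = r\<close>,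
  where the forest of children is \<open>r\<close> leaves: with \<open>t = r + j\<close> the number \<open>X\<close> of lists with \<open>r\<close> zeros
  and sum \<open>r\<close> is \<open>C(r+j, r) C(r-1, j-1)\<close>, so \<open>r X = (r+1) C(r+j, r+1) C(r, j)\<close> and \<open>r + 1\<close> divides \<open>X\<close>.\<close>

subsection \<open>Dyck paths and plane forests\<close>

datatype tree = Node (kids: "tree list")

fun word :: "tree list \<Rightarrow> step list" where
  "word [] = []"
| "word (Node cs # ts) = U # word cs @ D # word ts"

fun nodes :: "tree list \<Rightarrow> nat" where
  "nodes [] = 0"
| "nodes (Node cs # ts) = Suc (nodes cs + nodes ts)"

fun depth :: "tree list \<Rightarrow> nat" where
  "depth [] = 0"
| "depth (Node cs # ts) = max (Suc (depth cs)) (depth ts)"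

text \<open>Roots have depth 1. The depth is an integer, as in \<open>peaks\<close>; no leaf has
  depth \<le> 0, so the argument \<open>h - 1\<close> needs no guard.\<close>

fun leaves :: "tree list \<Rightarrow> int \<Rightarrow> nat" where
  "leaves [] h = 0"
| "leaves (Node cs # ts) h = of_bool (cs = [] \<and> h = 1) + leaves cs (h - 1) + leaves ts h"

text \<open>The starting height \<open>m\<close> is free so that removing the first step leaves a
  condition of the same kind; Dyck paths are the case \<open>m = 0\<close>.\<close>

fun path_from :: "nat \<Rightarrow> step list \<Rightarrow> bool" where
  "path_from m [] \<longleftrightarrow> m = 0"
| "path_from m (U # w) \<longleftrightarrow> path_from (Suc m) w"
| "path_from (Suc m) (D # w) \<longleftrightarrow> path_from m w"
| "path_from 0 (D # w) \<longleftrightarrow> False"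

text \<open>A path that starts at height \<open>m\<close>, stays nonnegative and ends at height \<open>0\<close> is uniquely a
  sequence of \<open>m + 1\<close> contours separated by the \<open>m\<close> down steps that reach a new minimum; \<open>parse\<close>
  returns these \<open>m + 1\<close> forests.\<close>

fun parse :: "step list \<Rightarrow> tree list list" where
  "parse [] = [[]]"
| "parse (D # w) = [] # parse w"
| "parse (U # w) = (case parse w of f # g # fs \<Rightarrow> (Node f # g) # fs | _ \<Rightarrow> [])"

fun join :: "tree list list \<Rightarrow> step list" where
  "join [] = []"
| "join [f] = word f"
| "join (f # g # fs) = word f @ D # join (g # fs)"

section \<open>Dyck paths as contours of unique forests\<close>

lemma height_0 [simp]: "height w 0 = 0"
  by (simp add: height_def)

lemma height_Cons_Suc [simp]: "height (x # w) (Suc i) = rise x + height w i"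
  by (simp add: height_def)

lemma all_le_Suc_iff: "(\<forall>i\<le>Suc n. P i) \<longleftrightarrow> P 0 \<and> (\<forall>i\<le>n. P (Suc i))"
proof -
  have "(\<forall>i\<in>{..Suc n}. P i) \<longleftrightarrow> P 0 \<and> (\<forall>i\<in>{..n}. P (Suc i))"
    unfolding atMost_Suc_eq_insert_0 by blast
  then show ?thesis by (simp only: Ball_def atMost_iff)
qed

lemma path_from_iff:
  "path_from m w \<longleftrightarrow>
     int m + height w (length w) = 0 \<and> (\<forall>i\<le>length w. int m + height w i \<ge> 0)"
proof (induction m w rule: path_from.induct)
  case (1 m)
  show ?case by simp
next
  case (2 m w)
  have "int m + height (U # w) (Suc i) = int (Suc m) + height w i" for i by simp
  with 2 show ?case
    unfolding length_Cons all_le_Suc_iff path_from.simps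
    by (metis height_0 add_0_right of_nat_0_le_iff)
next
  case (3 m w)
  have "int (Suc m) + height (D # w) (Suc i) = int m + height w i" for i by simp
  with 3 show ?case
    unfolding length_Cons all_le_Suc_iff path_from.simps
    by (metis height_0 add_0_right of_nat_0_le_iff)
next
  case (4 w)
  have "\<not> 0 \<le> int 0 + height (D # w) (Suc 0)" "Suc 0 \<le> length (D # w)"
    by simp_all
  then show ?case
    unfolding path_from.simps by blast
qed

lemma dyck_path_iff: "dyck_path n w \<longleftrightarrow> length w = 2 * n \<and> path_from 0 w"
  by (auto simp: dyck_path_def path_from_iff)

lemma path_from_word [simp]: "path_from m (word F @ w) \<longleftrightarrow> path_from m w"
  by (induction F arbitrary: m w rule: word.induct) auto

lemma length_word [simp]: "length (word F) = 2 * nodes F"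
  by (induction F rule: word.induct) auto

text \<open>The contour of \<open>F\<close> returns to its starting level without going below it, so
  it only adds trees to the first forest of \<open>parse w\<close>. The case \<open>w = []\<close>
  recovers \<open>F\<close> from \<open>word F\<close>.\<close>

lemma parse_word:
  "parse w = f # fs \<Longrightarrow> parse (word F @ w) = (F @ f) # fs"
  by (induction F arbitrary: w f fs rule: word.induct) auto

lemma inj_word: "inj word"
  by (rule injI) (metis append_Nil2 parse.simps(1) parse_word list.inject)

text \<open>The length claim supports the induction: after an up step \<open>parse w\<close> has at
  least two forests, so the default branch of \<open>parse\<close> is never taken. For
  \<open>m = 0\<close> every Dyck path is seen to be a contour.\<close>

lemma join_parse: "path_from m w \<Longrightarrow> length (parse w) = Suc m \<and> join (parse w) = w"
proof (induction m w rule: path_from.induct)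
  case (2 m w)
  then obtain f g fs where "parse w = f # g # fs"
    by (auto simp: length_Suc_conv)
  with 2 show ?case by (cases fs) auto
next
  case (3 m w)
  then show ?case by (cases "parse w") auto
qed auto

lemma path_from_0_iff: "path_from 0 w \<longleftrightarrow> w \<in> range word"
proof
  assume "path_from 0 w"
  then obtain F where "parse w = [F]" "join (parse w) = w"
    using join_parse by (fastforce simp: length_Suc_conv)
  then show "w \<in> range word" by auto
next
  assume "w \<in> range word"
  then show "path_from 0 w"
    by (auto simp: path_from_word[where w = "[]", simplified])
qed

section \<open>Peaks and maximal height of a contour\<close>

lemma card_peaks_Nil [simp]: "card (peaks [] h) = 0"
  by (simp add: peaks_def)

text \<open>A prepended step shifts indices by 1 and heights by \<open>rise x\<close>; a new peak
  can only arise at index 0, at height 1.\<close>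

lemma card_peaks_Cons:
  "card (peaks (x # w) h) =
     of_bool (x = U \<and> w \<noteq> [] \<and> hd w = D \<and> h = 1) + card (peaks w (h - rise x))"
proof -
  have "j \<in> peaks (x # w) h \<longleftrightarrow>
      (case j of 0 \<Rightarrow> x = U \<and> w \<noteq> [] \<and> hd w = D \<and> h = 1
       | Suc i \<Rightarrow> i \<in> peaks w (h - rise x))" for j
    by (cases j; cases w) (auto simp: peaks_def)
  moreover have "j \<in> (if x = U \<and> w \<noteq> [] \<and> hd w = D \<and> h = 1 then {0} else {}) \<union> Suc ` peaks w (h - rise x) \<longleftrightarrow>
      (case j of 0 \<Rightarrow> x = U \<and> w \<noteq> [] \<and> hd w = D \<and> h = 1
       | Suc i \<Rightarrow> i \<in> peaks w (h - rise x))" for j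
    by (cases j) auto
  ultimately have "peaks (x # w) h =
      (if x = U \<and> w \<noteq> [] \<and> hd w = D \<and> h = 1 then {0} else {}) \<union> Suc ` peaks w (h - rise x)"
    by blast
  then show ?thesis
    by (simp add: card_image finite_peaks)
qed

text \<open>A nonempty contour ends with \<open>D\<close> at height 0, so no peak straddles the
  boundary and the heights along \<open>w\<close> are unchanged.\<close>

lemma card_peaks_word_append:
  "card (peaks (word F @ w) h) = leaves F h + card (peaks w h)"
proof (induction F arbitrary: w h rule: word.induct)
  case (2 cs ts)
  \<comment> \<open>The up step of a root is followed by \<open>D\<close> exactly when that root is
    a leaf.\<close>
  have "hd (word cs @ D # v) = D \<longleftrightarrow> cs = []" for v
    by (cases cs rule: word.cases) auto
  with 2 show ?case by (auto simp: card_peaks_Cons)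
qed simp

lemma card_peaks_word: "card (peaks (word F) h) = leaves F h"
  using card_peaks_word_append[of F "[]"] by simp

lemma max_height_Nil [simp]: "max_height [] = 0"
  by (simp add: max_height_def)

lemma max_height_Cons: "max_height (x # w) = max 0 (rise x + max_height w)"
proof -
  have "{0..length (x # w)} = insert 0 (Suc ` {0..length w})"
    by (simp only: list.size atLeast0_atMost_Suc_eq_insert_0 add_0_right add_Suc_right)
  then have "height (x # w) ` {0..length (x # w)} =
      insert 0 ((\<lambda>a. rise x + a) ` height w ` {0..length w})"
    by (simp only: image_insert image_image height_Cons_Suc height_0)
  then show ?thesis
    using mono_Max_commute[of "\<lambda>a. rise x + a" "height w ` {0..length w}"]
    by (simp add: max_height_def mono_def)
qed

lemma max_height_nonneg: "max_height w \<ge> 0"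
  by (cases w) (auto simp: max_height_Cons)

lemma max_height_word_append: "max_height (word F @ w) = max (int (depth F)) (max_height w)"
proof (induction F arbitrary: w rule: word.induct)
  case 1
  show ?case using max_height_nonneg[of w] by simp
next
  case (2 cs ts)
  then show ?case by (auto simp: max_height_Cons)
qed

lemma max_height_word: "max_height (word F) = int (depth F)"
  using max_height_word_append[of F "[]"] by simp

definition regular :: "nat \<Rightarrow> tree list \<Rightarrow> bool" where
  "regular r F \<longleftrightarrow> (\<forall>i \<in> {1..int (depth F)}. leaves F i = r)"

lemma regular_dyck_paths_eq: "regular_dyck_paths r n = word ` {F. nodes F = n \<and> regular r F}"
  by (auto simp: regular_dyck_paths_def dyck_path_iff path_from_0_iff max_height_word
      card_peaks_word regular_def)

subsection \<open>Peeling off the roots\<close>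

definition subforest :: "tree list \<Rightarrow> tree list" where
  "subforest F = concat (map kids F)"

definition degrees :: "tree list \<Rightarrow> nat list" where
  "degrees F = map (length \<circ> kids) F"

text \<open>Inverse of the passage from \<open>F\<close> to \<open>(degrees F, subforest F)\<close>,
  on pairs with \<open>length G = sum_list L\<close>.\<close>

fun graft :: "nat list \<Rightarrow> tree list \<Rightarrow> tree list" where
  "graft [] G = []"
| "graft (l # L) G = Node (take l G) # graft L (drop l G)"

lemma subforest_simps [simp]:
  "subforest [] = []" "subforest (Node cs # ts) = cs @ subforest ts"
  by (auto simp: subforest_def)

lemma degrees_simps [simp]:
  "degrees [] = []" "degrees (Node cs # ts) = length cs # degrees ts"
  by (auto simp: degrees_def)

lemma length_degrees [simp]: "length (degrees F) = length F"
  by (simp add: degrees_def)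

lemma length_subforest [simp]: "length (subforest F) = sum_list (degrees F)"
  by (induction F rule: word.induct) auto

lemma graft_degrees_subforest [simp]: "graft (degrees F) (subforest F) = F"
  by (induction F rule: word.induct) auto

lemma degrees_graft [simp]: "length G = sum_list L \<Longrightarrow> degrees (graft L G) = L"
  by (induction L arbitrary: G) auto

lemma subforest_graft [simp]: "length G = sum_list L \<Longrightarrow> subforest (graft L G) = G"
  by (induction L arbitrary: G) auto

lemma nodes_append [simp]: "nodes (F @ G) = nodes F + nodes G"
  by (induction F rule: word.induct) auto

lemma leaves_append [simp]: "leaves (F @ G) h = leaves F h + leaves G h"
  by (induction F arbitrary: h rule: word.induct) auto

lemma depth_append [simp]: "depth (F @ G) = max (depth F) (depth G)"
  by (induction F rule: word.induct) auto

lemma nodes_subforest: "nodes F = length F + nodes (subforest F)"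
  by (induction F rule: word.induct) auto

lemma length_le_nodes: "length F \<le> nodes F"
  by (induction F rule: word.induct) auto

lemma depth_subforest: "F \<noteq> [] \<Longrightarrow> depth F = Suc (depth (subforest F))"
proof (induction F rule: word.induct)
  case (2 cs ts)
  then show ?case by (cases "ts = []") auto
qed simp

lemma leaves_nonpos: "h \<le> 0 \<Longrightarrow> leaves F h = 0"
  by (induction F arbitrary: h rule: word.induct) auto

lemma leaves_1: "leaves F 1 = count_list (degrees F) 0"
  by (induction F rule: word.induct) (auto simp: leaves_nonpos)

lemma leaves_subforest: "h \<noteq> 1 \<Longrightarrow> leaves F h = leaves (subforest F) (h - 1)"
  by (induction F rule: word.induct) auto

lemma regular_Nil [simp]: "regular r []"
  by (simp add: regular_def)

text \<open>Leaves at depth 1 are the zeros of \<open>degrees F\<close>, and depth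
  \<open>i + 1\<close> in \<open>F\<close> is depth \<open>i\<close> in \<open>subforest F\<close>.
  An empty forest reaches no depth and would impose no condition on the number of zeros.\<close>

lemma regular_iff:
  assumes "F \<noteq> []"
  shows "regular r F \<longleftrightarrow> count_list (degrees F) 0 = r \<and> regular r (subforest F)"
proof -
  let ?d = "int (depth (subforest F))"
  have "{1..int (depth F)} = insert 1 ((\<lambda>i. i + 1) ` {1..?d})"
    using assms by (auto simp: depth_subforest)
  moreover have "leaves F (i + 1) = leaves (subforest F) i" if "i \<in> {1..?d}" for i
    using leaves_subforest[of "i + 1" F] that by auto
  ultimately show ?thesis
    by (simp add: regular_def leaves_1 del: image_add_atLeastAtMost')
qed

section \<open>Counting regular forests by nodes and roots\<close>

definition forests :: "nat \<Rightarrow> nat \<Rightarrow> nat \<Rightarrow> tree list set" where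
  "forests r n t = {F. nodes F = n \<and> length F = t \<and> regular r F}"

lemma finite_regular_forests: "finite {F. nodes F = n \<and> regular r F}"
proof (rule finite_imageD)
  show "finite (word ` {F. nodes F = n \<and> regular r F})"
    using finite_regular_dyck_paths[of r n] by (simp only: regular_dyck_paths_eq)
  show "inj_on word {F. nodes F = n \<and> regular r F}"
    using inj_word by (rule inj_on_subset) simp
qed

lemma finite_forests: "finite (forests r n t)"
  by (rule finite_subset[OF _ finite_regular_forests[of n r]]) (auto simp: forests_def)

lemma num_regular_dyck_paths_eq: "num_regular_dyck_paths r n = (\<Sum>t\<le>n. card (forests r n t))"
proof -
  have "{F. nodes F = n \<and> regular r F} = (\<Union>t\<le>n. forests r n t)"
    using length_le_nodes by (auto simp: forests_def)
  moreover have "card (\<Union>t\<le>n. forests r n t) = (\<Sum>t\<le>n. card (forests r n t))"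
    by (rule card_UN_disjoint) (auto simp: finite_forests, auto simp: forests_def)
  ultimately show ?thesis
    using inj_word by (simp add: num_regular_dyck_paths_def regular_dyck_paths_eq
        card_image inj_on_subset)
qed

lemma finite_bounded_sum_lists: "finite {L :: nat list. length L = t \<and> sum_list L \<le> n}"
  by (rule finite_subset[OF _ finite_lists_length_eq[of "{..n}" t]])
     (auto dest: member_le_sum_list)

text \<open>\<open>degrees\<close> and \<open>subforest\<close> give a bijection with inverse
  \<open>graft\<close>. The bound on \<open>sum_list L\<close> keeps the index set finite and loses
  nothing, since the \<open>n - t\<close> remaining nodes include all children of the roots.\<close>

lemma card_forests:
  assumes "0 < t" "t \<le> n"
  shows "card (forests r n t) =
    (\<Sum>L | length L = t \<and> count_list L 0 = r \<and> sum_list L \<le> n. card (forests r (n - t) (sum_list L)))"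
proof -
  let ?Ls = "{L. length L = t \<and> count_list L 0 = r \<and> sum_list L \<le> n}"
  let ?S = "SIGMA L : ?Ls. forests r (n - t) (sum_list L)"
  have fwd: "(degrees F, subforest F) \<in> ?S" if "F \<in> forests r n t" for F
  proof -
    from that assms have "F \<noteq> []" by (auto simp: forests_def)
    with that length_le_nodes[of "subforest F"] show ?thesis
      by (auto simp: forests_def regular_iff nodes_subforest[of F])
  qed
  have bwd: "graft L G \<in> forests r n t" if "(L, G) \<in> ?S" for L G
  proof -
    from that have G: "length G = sum_list L" by (auto simp: forests_def)
    then have "length (graft L G) = length L"
      using length_degrees[of "graft L G"] by (simp del: length_degrees)
    with that assms G show ?thesis
      by (auto simp: forests_def regular_iff nodes_subforest[of "graft L G"])
  qed
  have "bij_betw (\<lambda>F. (degrees F, subforest F)) (forests r n t) ?S"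
    by (rule bij_betw_byWitness[where f' = "\<lambda>(L, G). graft L G"])
       (use fwd bwd in \<open>auto simp: forests_def\<close>)
  then have "card (forests r n t) = card ?S"
    by (rule bij_betw_same_card)
  also have "\<dots> = (\<Sum>L\<in>?Ls. card (forests r (n - t) (sum_list L)))"
    by (rule card_SigmaI)
       (auto simp: finite_forests intro: finite_subset[OF _ finite_bounded_sum_lists[of t n]])
  finally show ?thesis .
qed

lemma all_leaves:
  "count_list (degrees F) 0 = length F \<Longrightarrow> set F \<subseteq> {Node []}"
proof (induction F rule: word.induct)
  case (2 cs ts)
  \<comment> \<open>This bound prevents the other roots from making up for a root with
    children.\<close>
  have "count_list (degrees ts) 0 \<le> length ts"
    using count_le_length[of "degrees ts" 0] by simp
  with 2 show ?case by (auto split: if_splits)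
qed simp

lemma forests_bounds:
  assumes "F \<in> forests r n t" "0 < n"
  shows "count_list (degrees F) 0 = r" "r \<le> t" "t \<le> n"
proof -
  from assms have "F \<noteq> []" by (auto simp: forests_def)
  then show c: "count_list (degrees F) 0 = r"
    using assms by (auto simp: forests_def regular_iff)
  then show "r \<le> t"
    using count_le_length[of "degrees F" 0] assms by (simp add: forests_def)
  show "t \<le> n"
    using assms length_le_nodes[of F] by (auto simp: forests_def)
qed

text \<open>The chain \<open>r\<close> \<le> \<open>t\<close> \<le> \<open>n\<close> \<le>
  \<open>r\<close> collapses, so all \<open>r\<close> roots are leaves.\<close>

lemma forests_le:
  assumes "0 < n" "n \<le> r"
  shows "forests r n t \<subseteq> (if n = r \<and> t = r then {replicate r (Node [])} else {})"
proof
  fix F assume F: "F \<in> forests r n t"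
  with forests_bounds[OF F] assms
  have *: "n = r" "t = r" "length F = r" "count_list (degrees F) 0 = r"
    by (auto simp: forests_def)
  then have "F = replicate r (Node [])"
    using all_leaves[of F] by (intro replicate_eqI) auto
  with * show "F \<in> (if n = r \<and> t = r then {replicate r (Node [])} else {})"
    by simp
qed

lemma nodes_replicate_leaf [simp]: "nodes (replicate r (Node [])) = r"
  by (induction r) auto

lemma regular_replicate_leaf: "regular r (replicate r (Node []))"
proof (cases r)
  case (Suc m)
  have "degrees (replicate r (Node [])) = replicate r 0" "subforest (replicate r (Node [])) = []" for r
    by (simp_all add: degrees_def subforest_def)
  moreover have "count_list (replicate r 0) 0 = r" for r
    by (induction r) auto
  ultimately show ?thesis
    using Suc by (subst regular_iff) (auto simp del: replicate_Suc)
qed simp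

lemma card_forests_less: "0 < n \<Longrightarrow> n < r \<Longrightarrow> card (forests r n t) = 0"
  using forests_le[of n r t] by simp

lemma card_forests_eq: "0 < r \<Longrightarrow> card (forests r r t) = of_bool (t = r)"
proof (cases "t = r")
  case True
  assume "0 < r"
  with forests_le[of r r t] True have "forests r r t = {replicate r (Node [])}"
    by (auto simp: forests_def regular_replicate_leaf)
  with True show ?thesis by simp
next
  case False
  assume "0 < r"
  with forests_le[of r r t] False show ?thesis by simp
qed

subsection \<open>Lists with a given number of zeros and a given sum\<close>

text \<open>Subtracting 1 from each entry leaves weak compositions of \<open>s - j\<close> into
  \<open>j\<close> parts. The lower index \<open>s - j\<close> is also correct for
  \<open>j = 0\<close>, where a truncated \<open>j - 1\<close> would not be.\<close>

lemma card_positive_compositions: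
  assumes "j \<le> s"
  shows "card {L :: nat list. length L = j \<and> 0 \<notin> set L \<and> sum_list L = s} = (s - 1) choose (s - j)"
proof -
  have "L \<in> map Suc ` {K. length K = j \<and> sum_list K = s - j}"
    if "length L = j" "0 \<notin> set L" "sum_list L = s" for L
  proof
    show L: "L = map Suc (map (\<lambda>x. x - 1) L)"
      using that(2) by (induction L) auto
    have "sum_list (map Suc K) = sum_list K + length K" for K
      by (induction K) auto
    from this[of "map (\<lambda>x. x - 1) L"] that L
    show "map (\<lambda>x. x - 1) L \<in> {K. length K = j \<and> sum_list K = s - j}"
      by simp
  qed
  moreover have "sum_list (map Suc K) = sum_list K + length K" for K
    by (induction K) auto
  ultimately have "{L. length L = j \<and> 0 \<notin> set L \<and> sum_list L = s} =
      map Suc ` {K. length K = j \<and> sum_list K = s - j}"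
    using assms by auto
  then show ?thesis
    using assms by (simp add: card_image inj_on_def card_length_sum_list)
qed

text \<open>Such a list is an interleaving of \<open>r\<close> zeros with a positive composition of
  \<open>s\<close> into \<open>j\<close> parts.\<close>

lemma card_weak_compositions_zeros:
  assumes "j \<le> s"
  shows "card {L :: nat list. length L = r + j \<and> count_list L 0 = r \<and> sum_list L = s} =
    ((r + j) choose r) * ((s - 1) choose (s - j))"
proof -
  let ?P = "{L :: nat list. length L = j \<and> 0 \<notin> set L \<and> sum_list L = s}"
  let ?S = "\<lambda>ys. shuffles (replicate r 0) ys"
  have filter_zero: "filter (\<lambda>x. x = 0) L = replicate (count_list L 0) (0 :: nat)" for L
    by (induction L) auto
  have sum_pos: "sum_list (filter (\<lambda>x. x \<noteq> 0) L) = sum_list L" for L :: "nat list"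
    by (induction L) auto
  have len: "length (filter (\<lambda>x. x \<noteq> 0) L) + count_list L 0 = length L" for L :: "nat list"
    by (induction L) auto
  \<comment> \<open>Filtering recovers \<open>ys\<close> from any shuffle, so different
    \<open>ys\<close> have disjoint sets of shuffles.\<close>
  have pos: "filter (\<lambda>x. x \<noteq> 0) L = ys" "filter (\<lambda>x. x = 0) L = replicate r 0"
    if "L \<in> ?S ys" "ys \<in> ?P" for L ys
  proof -
    have d: "set (replicate r 0) \<inter> set ys = {}"
      using that(2) by auto
    have "filter (\<lambda>x. x \<noteq> 0) L = filter (\<lambda>x. x \<in> set ys) L"
      using set_shuffles[OF that(1)] that(2) by (intro filter_cong) (auto split: if_splits intro!: gr0I)
    then show *: "filter (\<lambda>x. x \<noteq> 0) L = ys"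
      using filter_shuffles_disjoint2(1)[OF d that(1)] by simp
    have "filter (\<lambda>x. x = 0) L = filter (\<lambda>x. x \<notin> set ys) L"
      using set_shuffles[OF that(1)] that(2) by (intro filter_cong) (auto split: if_splits intro!: gr0I)
    then show "filter (\<lambda>x. x = 0) L = replicate r 0"
      using filter_shuffles_disjoint2(2)[OF d that(1)] by simp
  qed
  have "{L. length L = r + j \<and> count_list L 0 = r \<and> sum_list L = s} = (\<Union>ys\<in>?P. ?S ys)"
  proof (intro equalityI subsetI)
    fix L assume L: "L \<in> {L. length L = r + j \<and> count_list L 0 = r \<and> sum_list L = s}"
    then have "filter (\<lambda>x. x \<noteq> 0) L \<in> ?P"
      using len[of L] sum_pos[of L] by auto
    moreover have "L \<in> ?S (filter (\<lambda>x. x \<noteq> 0) L)"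
      using partition_in_shuffles[of L "\<lambda>x. x = 0"] L by (simp add: filter_zero)
    ultimately show "L \<in> (\<Union>ys\<in>?P. ?S ys)" by blast
  next
    fix L assume "L \<in> (\<Union>ys\<in>?P. ?S ys)"
    then obtain ys where ys: "ys \<in> ?P" "L \<in> ?S ys" by blast
    then show "L \<in> {L. length L = r + j \<and> count_list L 0 = r \<and> sum_list L = s}"
      using pos[OF ys(2,1)] filter_zero[of L] sum_pos[of L] length_shuffles[OF ys(2)]
      by simp
  qed
  moreover have "card (\<Union>ys\<in>?P. ?S ys) = (\<Sum>ys\<in>?P. card (?S ys))"
  proof (rule card_UN_disjoint)
    show "finite ?P"
      by (rule finite_subset[OF _ finite_bounded_sum_lists[of j s]]) auto
    show "\<forall>ys\<in>?P. \<forall>zs\<in>?P. ys \<noteq> zs \<longrightarrow> ?S ys \<inter> ?S zs = {}"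
      using pos(1) by blast
  qed simp
  moreover have "(\<Sum>ys\<in>?P. card (?S ys)) = (\<Sum>ys\<in>?P. (r + j) choose r)"
    by (intro sum.cong refl) (subst card_disjoint_shuffles, auto)
  ultimately show ?thesis
    using card_positive_compositions[OF assms] by simp
qed

lemma dvd_card_weak_compositions:
  assumes "0 < r"
  shows "r + 1 dvd card {L :: nat list. length L = t \<and> count_list L 0 = r \<and> sum_list L = r}"
    (is "_ dvd card ?A")
proof (cases "r < t \<and> t \<le> 2 * r")
  case True
  then obtain k where "t = Suc (r + k)"
    using less_imp_Suc_add by blast
  with True have t: "t = r + Suc k" "k < r"
    by simp_all
  \<comment> \<open>By symmetry the lower index \<open>r - Suc k\<close> becomes \<open>k\<close>,
    and absorption applies.\<close>
  have "r * ((r - 1) choose (r - Suc k)) = Suc k * (r choose Suc k)"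
    using binomial_absorption[of k r] binomial_symmetric[of k "r - 1"] t(2)
    by (simp add: diff_diff_eq)
  \<comment> \<open>As \<open>Suc k = t - r\<close>, both sides equal
    \<open>t * ((t - 1) choose r)\<close>.\<close>
  moreover have "Suc k * (t choose r) = (r + 1) * (t choose (r + 1))"
    using binomial_absorb_comp[of t r] binomial_absorption[of r t] t by simp
  moreover have "card ?A = (t choose r) * ((r - 1) choose (r - Suc k))"
    using card_weak_compositions_zeros[of "Suc k" r r] t by simp
  ultimately have "r * card ?A = (r + 1) * ((t choose (r + 1)) * (r choose Suc k))"
    by (metis mult.assoc mult.left_commute)
  then have "r + 1 dvd r * card ?A"
    by (rule dvdI)
  moreover have "coprime (r + 1) r"
    by simp
  ultimately show ?thesis
    using coprime_dvd_mult_right_iff by blast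
next
  case False
  \<comment> \<open>The \<open>t - r\<close> nonzero entries sum to \<open>r > 0\<close>, so there
    is at least one and at most \<open>r\<close> of them.\<close>
  have False if L: "L \<in> ?A" for L
  proof -
    have "count_list L 0 \<le> length L"
      by (rule count_le_length)
    moreover have "length L \<le> count_list L 0 + sum_list L"
      by (induction L) auto
    moreover have "count_list L 0 = length L \<Longrightarrow> sum_list L = 0"
    proof (induction L)
      case (Cons a L)
      with count_le_length[of L 0] show ?case by (auto split: if_splits)
    qed simp
    ultimately show False
      using L False assms by (simp del: sum_list_eq_0_iff)
  qed
  then have "?A = {}" by blast
  then show ?thesis by (simp only: card.empty dvd_0_right)
qed

subsection \<open>Divisibility\<close>

lemma dvd_card_forests:
  assumes "0 < r" "r < n"
  shows "r + 1 dvd card (forests r n t)"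
  using \<open>r < n\<close>
proof (induction n arbitrary: t rule: less_induct)
  case (less n)
  show ?case
  \<comment> \<open>Outside this range there are no forests; inside it \<open>t > 0\<close>, so
    \<open>n - t < n\<close> and the induction hypothesis can apply.\<close>
  proof (cases "r \<le> t \<and> t \<le> n")
    case True
    let ?Ls = "{L :: nat list. length L = t \<and> count_list L 0 = r \<and> sum_list L \<le> n}"
    have t: "0 < t" "t \<le> n"
      using True assms by auto
    have fin: "finite ?Ls"
      by (rule finite_subset[OF _ finite_bounded_sum_lists[of t n]]) auto
    \<comment> \<open>With between 1 and \<open>r - 1\<close> nodes left all terms vanish, and with
      more than \<open>r\<close> each term is divisible by induction.\<close>
    consider "n - t = 0" | "0 < n - t" "n - t < r" | "n - t = r" | "r < n - t"
      by linarith
    then have "r + 1 dvd (\<Sum>L\<in>?Ls. card (forests r (n - t) (sum_list L)))"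
    proof cases
      case 3
      \<comment> \<open>Only lists with sum \<open>r\<close> contribute, each exactly 1; the bound
        \<open>sum_list L\<close> \<le> \<open>n\<close> then follows from
        \<open>r < n\<close>.\<close>
      have "{L \<in> ?Ls. sum_list L = r} =
          {L. length L = t \<and> count_list L 0 = r \<and> sum_list L = r}"
        using less.prems by auto
      then show ?thesis
        using 3 assms(1) fin dvd_card_weak_compositions[OF assms(1), of t]
        by (simp add: card_forests_eq sum.If_cases of_bool_def Int_def)
    next
      case 1
      have "card (forests r 0 (sum_list L)) = 0" if "L \<in> ?Ls" for L
      proof -
        \<comment> \<open>Here \<open>t = n > r\<close>, so \<open>L\<close> has a nonzero entry and
          demands children, but no nodes are left.\<close>
        have "0 < sum_list L"
        proof (rule gr0I)
          assume "sum_list L = 0"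
          then have "count_list L 0 = length L"
            by (induction L) auto
          with that 1 t less.prems show False by simp
        qed
        then have "F \<notin> forests r 0 (sum_list L)" for F
          using length_le_nodes[of F] by (auto simp: forests_def)
        then have "forests r 0 (sum_list L) = {}" by blast
        then show ?thesis by simp
      qed
      with 1 show ?thesis by (auto intro!: dvd_sum)
    qed (use less.IH t in \<open>auto intro!: dvd_sum simp: card_forests_less\<close>)
    then show ?thesis
      by (simp only: card_forests[OF t])
  next
    case False
    then have "forests r n t = {}"
      using forests_bounds(2,3)[of _ r n t] less.prems by auto
    then show ?thesis by simp
  qed
qed

theorem theorem3p8:
  fixes r n :: nat
  assumes "r \<ge> 1" and "n > r"
  shows "[num_regular_dyck_paths r n = 0] (mod (r + 1))"
  using assms dvd_card_forests[of r n]
  by (auto simp: num_regular_dyck_paths_eq cong_0_iff intro!: dvd_sum)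

end
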